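(* Let $q\ge 5$ with $q\equiv 1\pmod 4$, and consider the parameter set of the conference graph $C(q)$: a strongly regular graph with $n=q$, $k=(q-1)/2$, $\lambda=(q-5)/4$, $\mu=(q-1)/4$. Then $C(q)$ has a putative skew-symmetric fission scheme with four classes if and only if $q\equiv 5\pmod 8$ and there exist integers $g,h$ with $q=g^2+4h^2$ and $g\equiv 1\pmod 4$.
   Context: Setting: for a 2-class symmetric association scheme whose first nontrivial relation is a strongly regular graph with parameters $(n,k,\lambda,\mu)$, let $k_1=k$, $k_2=n-k-1$ and let its character table be $\begin{pmatrix}1&k_1&k_2\\1&r&t\\1&s&u\end{pmatrix}$ with row multiplicities $1,m_1,m_2$ (for $C(q)$: $r,s=(-1\pm\sqrt q)/2$ in either order, $m_1=m_2=(q-1)/2$). A 4-class skew-symmetric fission scheme has relations $R_0,R_1,R_2,R_2^T,R_1^T$ (only $R_0$ symmetric) with $R_1\cup R_1^T$ and $R_2\cup R_2^T$ the two relations of the 2-class scheme. Its character table (rows = primitive idempotents $E_0,\dots,E_4$ with multiplicities $1,m_1/2,m_2/2,m_2/2,m_1/2$, columns $R_0,R_1,R_2,R_2^T,R_1^T$) has the form $$P=\begin{pmatrix}1&k_1/2&k_2/2&k_2/2&k_1/2\\1&\rho&\tau&\bar\tau&\bar\rho\\1&\sigma&\omega&\bar\omega&\bar\sigma\\1&\bar\sigma&\bar\omega&\omega&\sigma\\1&\bar\rho&\bar\tau&\tau&\rho\end{pmatrix}$$ of one of three types: type I: $\rho=r/2$, $\sigma=(s+\sqrt{-b})/2$, $\tau=(t+\sqrt{-z})/2$,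 $\omega=u/2$, $b=nk_1/m_2$, $z=nk_2/m_1$; type II: $\rho=(r+\sqrt{-y})/2$, $\sigma=s/2$, $\tau=t/2$, $\omega=(u+\sqrt{-c})/2$, $y=nk_1/m_1$, $c=nk_2/m_2$; type III: $\rho=(r+\sqrt{-y})/2$, $\tau=(t+\sqrt{-z})/2$, $\sigma=(s+\sqrt{-b})/2$, $\omega=(u-\sqrt{-c})/2$ with $b,c,y,z>0$, $m_1y+m_2b=nk_1$, $m_1z+m_2c=nk_2$, $m_1\sqrt{yz}=m_2\sqrt{bc}$. The numbers $p^{\ell}_{ij}=\frac{1}{nk'_\ell}\sum_{h=0}^4 \mu_h p_{hi}p_{hj}\overline{p_{h\ell}}$ (with $k'_\ell$ the entries of the first row and $\mu_h$ the multiplicities) are the intersection numbers determined by $P$. A "putative" 4-class skew-symmetric fission scheme means such a matrix $P$ (of type I, II or III, for some admissible choice of the free parameters) for which all these intersection numbers are nonnegative integers. *)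

theory Defs
  imports Complex_Main "HOL-Number_Theory.Cong" "Jordan_Normal_Form.Matrix"
begin

(* The character table
     1  k  n-k-1      (multiplicity 1)
     1  r  t          (multiplicity m1)
     1  s  u          (multiplicity m2)
   determined by the parameters of a strongly regular graph. From
   A^2 = k I + lam A + mu (J - I - A), the two restricted eigenvalues r and s of the adjacency
   matrix A are the roots of x^2 = (lam - mu) x + (k - mu); they may be listed in either order.
   The complementary graph has the eigenvalues -1 - r and -1 - s, and the multiplicities follow
   from tr I = n and tr A = 0. *)
definition srg_character_table ::
    "nat \<Rightarrow> nat \<Rightarrow> nat \<Rightarrow> nat \<Rightarrow> real \<Rightarrow> real \<Rightarrow> real \<Rightarrow> real \<Rightarrow> nat \<Rightarrow> nat \<Rightarrow> bool" where
  "srg_character_table n k lam mu r s t u m1 m2 \<longleftrightarrow>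
     r \<noteq> s \<and>
     (\<forall>x\<in>{r, s}. x\<^sup>2 = (real lam - real mu) * x + (real k - real mu)) \<and>
     t = - 1 - r \<and> u = - 1 - s \<and>
     m1 > 0 \<and> m2 > 0 \<and> 1 + m1 + m2 = n \<and>
     real k + real m1 * r + real m2 * s = 0"

definition fission_matrix ::
    "nat \<Rightarrow> nat \<Rightarrow> complex \<Rightarrow> complex \<Rightarrow> complex \<Rightarrow> complex \<Rightarrow> complex mat" where
  "fission_matrix k1 k2 \<rho> \<sigma> \<tau> \<omega> = mat_of_rows_list 5
     [[1, of_nat k1 / 2, of_nat k2 / 2, of_nat k2 / 2, of_nat k1 / 2],
      [1, \<rho>,     \<tau>,     cnj \<tau>, cnj \<rho>],
      [1, \<sigma>,     \<omega>,     cnj \<omega>, cnj \<sigma>],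
      [1, cnj \<sigma>, cnj \<omega>, \<omega>,     \<sigma>],
      [1, cnj \<rho>, cnj \<tau>, \<tau>,     \<rho>]]"

definition fission_mults :: "nat \<Rightarrow> nat \<Rightarrow> real list" where
  "fission_mults m1 m2 = [1, real m1 / 2, real m2 / 2, real m2 / 2, real m1 / 2]"

(* Note that csqrt (- x) = i sqrt x for real x >= 0. *)
inductive fission_character_table ::
    "nat \<Rightarrow> nat \<Rightarrow> nat \<Rightarrow> real \<Rightarrow> real \<Rightarrow> real \<Rightarrow> real \<Rightarrow> nat \<Rightarrow> nat \<Rightarrow> complex mat \<Rightarrow> bool"
  for n k1 k2 :: nat and r s t u :: real and m1 m2 :: nat
where
  type_I:
    "\<lbrakk>b = real n * real k1 / real m2; z = real n * real k2 / real m1\<rbrakk> \<Longrightarrow>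
     fission_character_table n k1 k2 r s t u m1 m2
       (fission_matrix k1 k2
          (of_real r / 2)
          ((of_real s + csqrt (- of_real b)) / 2)
          ((of_real t + csqrt (- of_real z)) / 2)
          (of_real u / 2))"
| type_II:
    "\<lbrakk>y = real n * real k1 / real m1; c = real n * real k2 / real m2\<rbrakk> \<Longrightarrow>
     fission_character_table n k1 k2 r s t u m1 m2
       (fission_matrix k1 k2
          ((of_real r + csqrt (- of_real y)) / 2)
          (of_real s / 2)
          (of_real t / 2)
          ((of_real u + csqrt (- of_real c)) / 2))"
| type_III:
    "\<lbrakk>b > 0; c > 0; y > 0; z > 0;
      real m1 * y + real m2 * b = real n * real k1;
      real m1 * z + real m2 * c = real n * real k2;
      real m1 * sqrt (y * z) = real m2 * sqrt (b * c)\<rbrakk> \<Longrightarrow>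
     fission_character_table n k1 k2 r s t u m1 m2
       (fission_matrix k1 k2
          ((of_real r + csqrt (- of_real y)) / 2)
          ((of_real s + csqrt (- of_real b)) / 2)
          ((of_real t + csqrt (- of_real z)) / 2)
          ((of_real u - csqrt (- of_real c)) / 2))"

definition intersection_number ::
    "nat \<Rightarrow> real list \<Rightarrow> complex mat \<Rightarrow> nat \<Rightarrow> nat \<Rightarrow> nat \<Rightarrow> complex" where
  "intersection_number n \<mu> P i j l =
     1 / (of_nat n * P $$ (0, l)) *
     (\<Sum>h = 0..4. of_real (\<mu> ! h) * P $$ (h, i) * P $$ (h, j) * cnj (P $$ (h, l)))"

definition has_putative_skew_fission :: "nat \<Rightarrow> nat \<Rightarrow> nat \<Rightarrow> nat \<Rightarrow> bool" where
  "has_putative_skew_fission n k lam mu \<longleftrightarrow>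
     (\<exists>r s t u m1 m2 P.
        srg_character_table n k lam mu r s t u m1 m2 \<and>
        fission_character_table n k (n - k - 1) r s t u m1 m2 P \<and>
        (\<forall>i\<le>4. \<forall>j\<le>4. \<forall>l\<le>4.
           intersection_number n (fission_mults m1 m2) P i j l \<in> \<nat>))"

lemma srg_character_table_conference:
  fixes q :: nat
  assumes "q \<ge> 5" and "[q = 1] (mod 4)"
  shows "srg_character_table q ((q - 1) div 2) ((q - 5) div 4) ((q - 1) div 4) r s t u m1 m2 \<longleftrightarrow>
    (r = (- 1 + sqrt (real q)) / 2 \<and> s = (- 1 - sqrt (real q)) / 2 \<or>
     r = (- 1 - sqrt (real q)) / 2 \<and> s = (- 1 + sqrt (real q)) / 2) \<and>
    t = - 1 - r \<and> u = - 1 - s \<and> m1 = (q - 1) div 2 \<and> m2 = (q - 1) div 2"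
    (is "?L \<longleftrightarrow> ?R")
proof -
  have "q mod 4 = 1" using assms by (simp add: cong_def)
  then obtain a where a: "q = 4 * a + 1" by (metis mod_eq_nat1E mult.commute div_mult_mod_eq)
  have a1: "a \<ge> 1" using a assms by simp
  have p: "(q - 1) div 2 = 2 * a" "(q - 5) div 4 = a - 1" "(q - 1) div 4 = a"
    using a a1 by auto
  define w where "w = sqrt (real q)"
  have w2: "w * w = 4 * real a + 1" unfolding w_def using a by simp
  have w0: "w > 0" unfolding w_def using a by simp
  have root: "x\<^sup>2 = (real (a - 1) - real a) * x + (real (2 * a) - real a) \<longleftrightarrow>
      x = (- 1 + w) / 2 \<or> x = (- 1 - w) / 2" for x
  proof -
    have "x\<^sup>2 = (real (a - 1) - real a) * x + (real (2 * a) - real a) \<longleftrightarrow>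
        (x - (- 1 + w) / 2) * (x - (- 1 - w) / 2) = 0"
      using a1 w2 by (auto simp: of_nat_diff field_simps power2_eq_square)
    then show ?thesis by auto
  qed
  have mult: "real m1 = real m2"
    if "1 + m1 + m2 = q" "2 * real a + real m1 * ((- 1 + e) / 2) + real m2 * ((- 1 - e) / 2) = 0"
      "e \<noteq> 0" for e
  proof -
    have "real m1 + real m2 = 4 * real a" using that(1) a by linarith
    moreover have "real m1 * ((- 1 + e) / 2) + real m2 * ((- 1 - e) / 2) =
        ((real m1 - real m2) * e - (real m1 + real m2)) / 2"
      by (simp add: field_simps)
    ultimately have "2 * real a + ((real m1 - real m2) * e - 4 * real a) / 2 = 0"
      using that(2) by (simp only: add.assoc)
    then have "(real m1 - real m2) * e = 0" by argo
    then show ?thesis using that(3) by simp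
  qed
  show ?thesis
  proof
    assume L: ?L
    note L = L[unfolded srg_character_table_def p]
    have rs: "r = (- 1 + w) / 2 \<and> s = (- 1 - w) / 2 \<or> r = (- 1 - w) / 2 \<and> s = (- 1 + w) / 2"
      using L root by auto
    have n: "1 + m1 + m2 = q" and tr: "2 * real a + real m1 * r + real m2 * s = 0"
      using L by simp_all
    from rs have "real m1 = real m2"
    proof (elim disjE conjE)
      assume rs: "r = (- 1 + w) / 2" "s = (- 1 - w) / 2"
      show ?thesis using mult[of w, OF n tr[unfolded rs]] w0 by simp
    next
      assume rs: "r = (- 1 - w) / 2" "s = (- 1 + w) / 2"
      have "2 * real a + real m1 * ((- 1 + - w) / 2) + real m2 * ((- 1 - - w) / 2) = 0"
        using tr[unfolded rs] by (simp only: diff_conv_add_uminus minus_minus)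
      then show ?thesis using mult[of "- w", OF n] w0 by simp
    qed
    then have "m1 = m2" "m1 = 2 * a" using L a by auto
    then show ?R using L rs unfolding p w_def by auto
  next
    assume R: ?R
    note R = R[unfolded p, folded w_def]
    have "r + s = - 1" using R by (auto simp: field_simps)
    moreover have "real m1 * r + real m2 * s = real (2 * a) * (r + s)"
      using R by (simp only: distrib_left)
    ultimately have "real m1 * r + real m2 * s = - real (2 * a)" by simp
    then show ?L unfolding srg_character_table_def p
      using R root a a1 w0 by auto
  qed
qed

end

theory Submission
  imports Defs
begin

text \<open>
  Write \<open>q = 4 * a + 1\<close> and \<open>w\<close> for a square root of \<open>q\<close>. Up to a degenerate sign, in all three types
  the eigenvalues \<open>\<rho>, \<sigma>, cnj \<rho>, cnj \<sigma>\<close> behave like the quartic Gaussian periods of a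
  field with \<open>q\<close> elements: the nontrivial columns of the table are cyclic shifts of this sequence. Hence, apart from
  trivial values, there are only five intersection numbers, and they are given by the formulas
  for the cyclotomic numbers of order 4, with the reals \<open>g = w * (x\<^sup>2 - v\<^sup>2) / q\<close> and
  \<open>h = w * x * v / q\<close>, where \<open>x\<close> and \<open>v\<close> are twice the imaginary parts of \<open>\<rho>\<close> and \<open>\<sigma>\<close>; these satisfy
  \<open>q = g\<^sup>2 + 4 * h\<^sup>2\<close>. Integrality of three of the numbers makes \<open>g\<close> and \<open>h\<close> odd integers
  and yields the congruences; conversely, in terms of \<open>g = 4 * j + 1\<close> and \<open>h = 2 * k + 1\<close> all five
  are manifestly nonnegative integers.
\<close>

section \<open>Polynomial identities for the quartic periods\<close>

text \<open>Here \<open>x\<close> and \<open>v\<close> stand for \<open>\<i>\<close> times the real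
  quantities, hence the minus signs in \<open>xv\<close>, \<open>g\<close> and \<open>h\<close>.
  Working in an arbitrary field of characteristic 0, with no conjugation left, makes every claim a
  polynomial identity in \<open>w\<close>, \<open>x\<close>, \<open>v\<close>, \<open>g\<close>,
  \<open>h\<close>, \<open>a\<close> modulo the four relations. The cubic sums run over the cyclic
  shifts of one product of three periods.\<close>

lemma gaussian_period_sums:
  fixes \<eta>0 \<eta>1 \<eta>2 \<eta>3 a g h w x v :: "'a :: field_char_0"
  assumes \<eta>: "\<eta>0 = (w - 1 + 2 * x) / 4" "\<eta>1 = (- w - 1 + 2 * v) / 4"
      "\<eta>2 = (w - 1 - 2 * x) / 4" "\<eta>3 = (- w - 1 - 2 * v) / 4"
    and w: "w\<^sup>2 = 4 * a + 1" and xv: "x\<^sup>2 + v\<^sup>2 = - (4 * a + 1)"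
    and g: "w * (x\<^sup>2 - v\<^sup>2) = - (4 * a + 1) * g" and h: "w * x * v = - (4 * a + 1) * h"
  shows
    "\<eta>0 + \<eta>1 + \<eta>2 + \<eta>3 = - 1" (is ?C1)
    "\<eta>0 * \<eta>0 + \<eta>1 * \<eta>1 + \<eta>2 * \<eta>2 + \<eta>3 * \<eta>3 = - a" (is ?C2)
    "\<eta>0 * \<eta>1 + \<eta>1 * \<eta>2 + \<eta>2 * \<eta>3 + \<eta>3 * \<eta>0 = - a" (is ?C3)
    "2 * (\<eta>0 * \<eta>2 + \<eta>1 * \<eta>3) = 3 * a + 1" (is ?C4)
    "8 * (a * a + (\<eta>0 * \<eta>0 * \<eta>0 + \<eta>1 * \<eta>1 * \<eta>1 + \<eta>2 * \<eta>2 * \<eta>2 + \<eta>3 * \<eta>3 * \<eta>3)) = (4 * a + 1) * (2 * a + 1 - 3 * g)" (is ?C5)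
    "8 * (a * a + (\<eta>0 * \<eta>0 * \<eta>1 + \<eta>1 * \<eta>1 * \<eta>2 + \<eta>2 * \<eta>2 * \<eta>3 + \<eta>3 * \<eta>3 * \<eta>0)) = (4 * a + 1) * (2 * a + 1 + g - 4 * h)" (is ?C6)
    "8 * (a * a + (\<eta>0 * \<eta>0 * \<eta>2 + \<eta>1 * \<eta>1 * \<eta>3 + \<eta>2 * \<eta>2 * \<eta>0 + \<eta>3 * \<eta>3 * \<eta>1)) = (4 * a + 1) * (2 * a - 3 + g)" (is ?C7)
    "8 * (a * a + (\<eta>0 * \<eta>0 * \<eta>3 + \<eta>1 * \<eta>1 * \<eta>0 + \<eta>2 * \<eta>2 * \<eta>1 + \<eta>3 * \<eta>3 * \<eta>2)) = (4 * a + 1) * (2 * a + 1 + g + 4 * h)" (is ?C8)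
    "8 * (a * a + (\<eta>0 * \<eta>1 * \<eta>2 + \<eta>1 * \<eta>2 * \<eta>3 + \<eta>2 * \<eta>3 * \<eta>0 + \<eta>3 * \<eta>0 * \<eta>1)) = (4 * a + 1) * (2 * a - 1 - g)" (is ?C9)
proof -
  \<comment> \<open>\<open>quad\<close>, \<open>quad2\<close> and \<open>cubic\<close> clear the
    denominators 4, so that only polynomial goals reach the Groebner basis procedure.\<close>
  have quad: "c * (A / 4 * (B / 4) + C / 4 * (D / 4) + E / 4 * (F / 4) + G / 4 * (H / 4)) = R"
    if "c * (A * B + C * D + E * F + G * H) = 16 * R" for A B C D E F G H R c :: 'a
    using that by (simp add: field_simps)
  have quad2: "2 * (A / 4 * (B / 4) + C / 4 * (D / 4)) = R"
    if "2 * (A * B + C * D) = 16 * R" for A B C D R :: 'a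
    using that by (simp add: field_simps)
  have cubic: "8 * (a * a + (A0 / 4 * (B0 / 4) * (C0 / 4) + A1 / 4 * (B1 / 4) * (C1 / 4) +
      A2 / 4 * (B2 / 4) * (C2 / 4) + A3 / 4 * (B3 / 4) * (C3 / 4))) = R"
    if "64 * a * a + (A0 * B0 * C0 + A1 * B1 * C1 + A2 * B2 * C2 + A3 * B3 * C3) = 8 * R"
    for A0 A1 A2 A3 B0 B1 B2 B3 C0 C1 C2 C3 R :: 'a
    using that by (simp add: field_simps)
  show ?C1
    unfolding \<eta> by (simp add: field_simps)
  \<comment> \<open>The unqualified name \<open>algebra\<close> refers to the method of HOL-Algebra here.\<close>
  show ?C2
    unfolding \<eta> by (rule quad[where c = 1, unfolded mult_1_left]) (use w xv in Groebner_Basis.algebra)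
  show ?C3
    unfolding \<eta> by (rule quad[where c = 1, unfolded mult_1_left]) (use w xv in Groebner_Basis.algebra)
  show ?C4
    unfolding \<eta> by (rule quad2) (use w xv in Groebner_Basis.algebra)
  show ?C5 ?C6 ?C7 ?C8 ?C9
    unfolding \<eta> by (rule cubic, use w xv g h in Groebner_Basis.algebra)+
qed

section \<open>Intersection numbers of fission matrices\<close>

lemma fission_matrix_index:
  "i < 5 \<Longrightarrow> j < 5 \<Longrightarrow> fission_matrix k1 k2 \<rho> \<sigma> \<tau> \<omega> $$ (i, j) =
     [[1, of_nat k1 / 2, of_nat k2 / 2, of_nat k2 / 2, of_nat k1 / 2],
      [1, \<rho>,     \<tau>,     cnj \<tau>, cnj \<rho>],
      [1, \<sigma>,     \<omega>,     cnj \<omega>, cnj \<sigma>],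
      [1, cnj \<sigma>, cnj \<omega>, \<omega>,     \<sigma>],
      [1, cnj \<rho>, cnj \<tau>, \<tau>,     \<rho>]] ! i ! j"
  unfolding fission_matrix_def by (simp add: mat_of_rows_list_def)

lemma fission_matrix_entries:
  fixes a :: nat and \<rho> \<sigma> \<tau> \<omega> :: complex
  defines "P \<equiv> fission_matrix (2 * a) (2 * a) \<rho> \<sigma> \<tau> \<omega>"
  shows
    "P $$ (0, 0) = 1" "P $$ (0, 1) = of_nat a" "P $$ (0, 2) = of_nat a" "P $$ (0, 3) = of_nat a" "P $$ (0, 4) = of_nat a"
    "P $$ (1, 0) = 1" "P $$ (1, 1) = \<rho>" "P $$ (1, 2) = \<tau>" "P $$ (1, 3) = cnj \<tau>" "P $$ (1, 4) = cnj \<rho>"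
    "P $$ (2, 0) = 1" "P $$ (2, 1) = \<sigma>" "P $$ (2, 2) = \<omega>" "P $$ (2, 3) = cnj \<omega>" "P $$ (2, 4) = cnj \<sigma>"
    "P $$ (3, 0) = 1" "P $$ (3, 1) = cnj \<sigma>" "P $$ (3, 2) = cnj \<omega>" "P $$ (3, 3) = \<omega>" "P $$ (3, 4) = \<sigma>"
    "P $$ (4, 0) = 1" "P $$ (4, 1) = cnj \<rho>" "P $$ (4, 2) = cnj \<tau>" "P $$ (4, 3) = \<tau>" "P $$ (4, 4) = \<rho>"
  by (simp_all add: P_def fission_matrix_index)

lemma intersection_number_fission:
  fixes a n i j l :: nat and \<rho> \<sigma> \<tau> \<omega> :: complex
  defines "P \<equiv> fission_matrix (2 * a) (2 * a) \<rho> \<sigma> \<tau> \<omega>"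
  assumes "i \<le> 4" "j \<le> 4" "l \<le> 4"
  shows "intersection_number n (fission_mults (2 * a) (2 * a)) P i j l =
    (P $$ (0, i) * P $$ (0, j) * P $$ (0, l) +
     of_nat a * (P $$ (1, i) * P $$ (1, j) * cnj (P $$ (1, l)) + P $$ (2, i) * P $$ (2, j) * cnj (P $$ (2, l)) +
       P $$ (3, i) * P $$ (3, j) * cnj (P $$ (3, l)) + P $$ (4, i) * P $$ (4, j) * cnj (P $$ (4, l)))) /
     (of_nat n * P $$ (0, l))"
proof -
  have "l \<in> {0,1,2,3,4}" using assms(4) by auto
  then have "cnj (P $$ (0, l)) = P $$ (0, l)" by (auto simp: P_def fission_matrix_index)
  then show ?thesis
    unfolding intersection_number_def fission_mults_def
    by (simp add: numeral_eq_Suc algebra_simps add_divide_distrib)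
qed

text \<open>With rows and columns taken in the order 1, 2, 4, 3, the nontrivial block is the
  circulant of \<open>\<rho>, \<sigma>, cnj \<rho>, cnj \<sigma>\<close>, and conjugation is a shift
  by two. A product of three nontrivial columns therefore depends only on a 3-element multiset of
  residues modulo 4 up to rotation. There are 20 / 4 = 5 of these, namely \<open>s000\<close> to
  \<open>s012\<close>.\<close>

lemma intersection_numbers_in_Nats:
  fixes a :: nat and \<rho> \<sigma> :: complex
  assumes a: "a > 0"
  defines "K \<equiv> complex_of_nat a" and "q \<equiv> complex_of_nat (4 * a + 1)"
  assumes
    s1: "\<rho> + \<sigma> + cnj \<rho> + cnj \<sigma> = - 1" and
    s20: "\<rho> * \<rho> + \<sigma> * \<sigma> + cnj \<rho> * cnj \<rho> + cnj \<sigma> * cnj \<sigma> = - K" and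
    s21: "\<rho> * \<sigma> + \<sigma> * cnj \<rho> + cnj \<rho> * cnj \<sigma> + cnj \<sigma> * \<rho> = - K" and
    s22: "2 * (\<rho> * cnj \<rho> + \<sigma> * cnj \<sigma>) = 3 * K + 1" and
    s000: "(K * K + (\<rho> * \<rho> * \<rho> + \<sigma> * \<sigma> * \<sigma> + cnj \<rho> * cnj \<rho> * cnj \<rho> + cnj \<sigma> * cnj \<sigma> * cnj \<sigma>)) / q \<in> \<nat>" and
    s001: "(K * K + (\<rho> * \<rho> * \<sigma> + \<sigma> * \<sigma> * cnj \<rho> + cnj \<rho> * cnj \<rho> * cnj \<sigma> + cnj \<sigma> * cnj \<sigma> * \<rho>)) / q \<in> \<nat>" and
    s002: "(K * K + (\<rho> * \<rho> * cnj \<rho> + \<sigma> * \<sigma> * cnj \<sigma> + cnj \<rho> * cnj \<rho> * \<rho> + cnj \<sigma> * cnj \<sigma> * \<sigma>)) / q \<in> \<nat>" and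
    s003: "(K * K + (\<rho> * \<rho> * cnj \<sigma> + \<sigma> * \<sigma> * \<rho> + cnj \<rho> * cnj \<rho> * \<sigma> + cnj \<sigma> * cnj \<sigma> * cnj \<rho>)) / q \<in> \<nat>" and
    s012: "(K * K + (\<rho> * \<sigma> * cnj \<rho> + \<sigma> * cnj \<rho> * cnj \<sigma> + cnj \<rho> * cnj \<sigma> * \<rho> + cnj \<sigma> * \<rho> * \<sigma>)) / q \<in> \<nat>"
  assumes "i \<le> 4" "j \<le> 4" "l \<le> 4"
  shows "intersection_number (4 * a + 1) (fission_mults (2 * a) (2 * a)) (fission_matrix (2 * a) (2 * a) \<rho> \<sigma> \<sigma> (cnj \<rho>)) i j l \<in> \<nat>"
proof -
  have q: "q = 4 * K + 1" "q \<noteq> 0" unfolding q_def K_def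
    by (simp, simp only: of_nat_eq_0_iff)
  have K: "K \<noteq> 0" "K \<in> \<nat>" using a unfolding K_def by auto
  \<comment> \<open>\<open>e0\<close> to \<open>e4\<close> cover the cases with a zero index: two
    zeros in \<open>e0\<close>, one in \<open>e1\<close> to \<open>e3\<close>, three in
    \<open>e4\<close>. The denominator is \<open>q\<close> for \<open>l = 0\<close> and
    \<open>q * K\<close> otherwise.\<close>
  have e0: "(K + K * (\<rho> + \<sigma> + cnj \<rho> + cnj \<sigma>)) / q \<in> \<nat>"
     "(K + K * (\<rho> + \<sigma> + cnj \<rho> + cnj \<sigma>)) / (q * K) \<in> \<nat>" unfolding s1 by simp_all
  have e1: "(K * K + K * (\<rho> * \<rho> + \<sigma> * \<sigma> + cnj \<rho> * cnj \<rho> + cnj \<sigma> * cnj \<sigma>)) / q \<in> \<nat>"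
    "(K * K + K * (\<rho> * \<rho> + \<sigma> * \<sigma> + cnj \<rho> * cnj \<rho> + cnj \<sigma> * cnj \<sigma>)) / (q * K) \<in> \<nat>"
     unfolding s20 by simp_all
  have e2: "(K * K + K * (\<rho> * \<sigma> + \<sigma> * cnj \<rho> + cnj \<rho> * cnj \<sigma> + cnj \<sigma> * \<rho>)) / q \<in> \<nat>"
    "(K * K + K * (\<rho> * \<sigma> + \<sigma> * cnj \<rho> + cnj \<rho> * cnj \<sigma> + cnj \<sigma> * \<rho>)) / (q * K) \<in> \<nat>"
     unfolding s21 by simp_all
  have "K * K + K * (\<rho> * cnj \<rho> + \<sigma> * cnj \<sigma> + cnj \<rho> * \<rho> + cnj \<sigma> * \<sigma>) = q * K"
    using s22 unfolding q by (simp add: algebra_simps)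
  then have e3: "(K * K + K * (\<rho> * cnj \<rho> + \<sigma> * cnj \<sigma> + cnj \<rho> * \<rho> + cnj \<sigma> * \<sigma>)) / q \<in> \<nat>"
    "(K * K + K * (\<rho> * cnj \<rho> + \<sigma> * cnj \<sigma> + cnj \<rho> * \<rho> + cnj \<sigma> * \<sigma>)) / (q * K) \<in> \<nat>"
    using q(2) K by simp_all
  have e4: "(1 + K * (1 + 1 + 1 + 1)) / q \<in> \<nat>" using q(2) by (simp add: q(1) algebra_simps)
  have canc: "(K * K * K + K * S) / (q * K) = (K * K + S) / q" for S
    using K(1) q(2) by (simp add: field_simps)
  have ijl: "i \<in> {0,1,2,3,4}" "j \<in> {0,1,2,3,4}" "l \<in> {0,1,2,3,4}" using assms by auto
  \<comment> \<open>After normalization modulo AC, each of the 125 cases is literally one of these facts.\<close>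
  note F = e0 e1 e2 e3 e4 s000 s001 s002 s003 s012
  show ?thesis
    unfolding intersection_number_fission[OF \<open>i \<le> 4\<close> \<open>j \<le> 4\<close> \<open>l \<le> 4\<close>]
    unfolding q_def[symmetric] K_def[symmetric]
    using ijl F
    by (elim insertE emptyE; hypsubst)
      (simp_all only: fission_matrix_entries K_def[symmetric] canc complex_cnj_cnj complex_cnj_one complex_cnj_of_nat
          mult_1_left mult_1_right div_by_1,
        simp_all only: ac_simps)
qed

section \<open>Fission tables of the conference graph\<close>

lemma csqrt_minus_of_real: "x \<ge> 0 \<Longrightarrow> csqrt (- of_real x) = \<i> * of_real (sqrt x)"
  using csqrt_of_real_nonpos[of "- of_real x"] by simp

text \<open>The sign of \<open>w\<close> selects the eigenvalue of the graph whose half is the real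
  part, and \<open>x\<close> is twice the imaginary part. Degenerate entries are included as
  \<open>x = 0\<close>.\<close>

definition conference_period :: "real \<Rightarrow> real \<Rightarrow> complex" where
  "conference_period w x = (of_real ((- 1 + w) / 2) + \<i> * of_real x) / 2"

lemma conference_period_sums:
  fixes w x v g h :: real and a :: nat
  assumes w: "w\<^sup>2 = 4 * real a + 1" and xv: "x\<^sup>2 + v\<^sup>2 = 4 * real a + 1"
    and g: "w * (x\<^sup>2 - v\<^sup>2) = (4 * real a + 1) * g" and h: "w * x * v = (4 * real a + 1) * h"
  defines "\<rho> \<equiv> conference_period w x" and "\<sigma> \<equiv> conference_period (- w) v"
    and "K \<equiv> complex_of_nat a"
  shows
    "\<rho> + \<sigma> + cnj \<rho> + cnj \<sigma> = - 1" (is ?C1)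
    "\<rho> * \<rho> + \<sigma> * \<sigma> + cnj \<rho> * cnj \<rho> + cnj \<sigma> * cnj \<sigma> = - K" (is ?C2)
    "\<rho> * \<sigma> + \<sigma> * cnj \<rho> + cnj \<rho> * cnj \<sigma> + cnj \<sigma> * \<rho> = - K" (is ?C3)
    "2 * (\<rho> * cnj \<rho> + \<sigma> * cnj \<sigma>) = 3 * K + 1" (is ?C4)
    "8 * (K * K + (\<rho> * \<rho> * \<rho> + \<sigma> * \<sigma> * \<sigma> + cnj \<rho> * cnj \<rho> * cnj \<rho> + cnj \<sigma> * cnj \<sigma> * cnj \<sigma>)) = (4 * K + 1) * (2 * K + 1 - 3 * of_real g)" (is ?C5)
    "8 * (K * K + (\<rho> * \<rho> * \<sigma> + \<sigma> * \<sigma> * cnj \<rho> + cnj \<rho> * cnj \<rho> * cnj \<sigma> + cnj \<sigma> * cnj \<sigma> * \<rho>)) = (4 * K + 1) * (2 * K + 1 + of_real g - 4 * of_real h)" (is ?C6)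
    "8 * (K * K + (\<rho> * \<rho> * cnj \<rho> + \<sigma> * \<sigma> * cnj \<sigma> + cnj \<rho> * cnj \<rho> * \<rho> + cnj \<sigma> * cnj \<sigma> * \<sigma>)) = (4 * K + 1) * (2 * K - 3 + of_real g)" (is ?C7)
    "8 * (K * K + (\<rho> * \<rho> * cnj \<sigma> + \<sigma> * \<sigma> * \<rho> + cnj \<rho> * cnj \<rho> * \<sigma> + cnj \<sigma> * cnj \<sigma> * cnj \<rho>)) = (4 * K + 1) * (2 * K + 1 + of_real g + 4 * of_real h)" (is ?C8)
    "8 * (K * K + (\<rho> * \<sigma> * cnj \<rho> + \<sigma> * cnj \<rho> * cnj \<sigma> + cnj \<rho> * cnj \<sigma> * \<rho> + cnj \<sigma> * \<rho> * \<sigma>)) = (4 * K + 1) * (2 * K - 1 - of_real g)" (is ?C9)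
proof -
  have K: "4 * K + 1 = of_real (4 * real a + 1)" by (simp add: K_def)
  have \<eta>: "\<rho> = (of_real w - 1 + 2 * (\<i> * of_real x)) / 4" "\<sigma> = (- of_real w - 1 + 2 * (\<i> * of_real v)) / 4"
    "cnj \<rho> = (of_real w - 1 - 2 * (\<i> * of_real x)) / 4" "cnj \<sigma> = (- of_real w - 1 - 2 * (\<i> * of_real v)) / 4"
    by (simp_all add: \<rho>_def \<sigma>_def conference_period_def field_simps)
  have w': "(of_real w)\<^sup>2 = 4 * K + 1"
    unfolding K w[symmetric] by simp
  have xv': "(\<i> * of_real x)\<^sup>2 + (\<i> * of_real v)\<^sup>2 = - (4 * K + 1)"
    unfolding K xv[symmetric] by (simp add: power_mult_distrib)
  have g': "of_real w * ((\<i> * of_real x)\<^sup>2 - (\<i> * of_real v)\<^sup>2) = - (4 * K + 1) * of_real g"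
    unfolding K mult_minus_left of_real_mult[symmetric] g[symmetric]
    by (simp add: power_mult_distrib algebra_simps)
  have h': "of_real w * (\<i> * of_real x) * (\<i> * of_real v) = - (4 * K + 1) * of_real h"
    unfolding K mult_minus_left of_real_mult[symmetric] h[symmetric] by (simp add: mult_ac)
  show ?C1 ?C2 ?C3 ?C4 ?C5 ?C6 ?C7 ?C8 ?C9
    by (rule gaussian_period_sums[OF \<eta> w' xv' g' h'])+
qed

text \<open>
  Types I and II are the limits \<open>x = 0\<close> and \<open>v = 0\<close> of type III, except that in type II the
  eigenvalue \<open>\<omega>\<close> is not conjugated.
\<close>

lemma conference_fission_character_tableE:
  fixes a :: nat and w :: real
  assumes "fission_character_table (4 * a + 1) (2 * a) (2 * a)
      ((- 1 + w) / 2) ((- 1 - w) / 2) ((- 1 - w) / 2) ((- 1 + w) / 2) (2 * a) (2 * a) P"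
    and a: "a > 0"
  obtains x v \<omega> where "x\<^sup>2 + v\<^sup>2 = 4 * real a + 1"
    "P = fission_matrix (2 * a) (2 * a) (conference_period w x) (conference_period (- w) v)
       (conference_period (- w) v) \<omega>"
    "\<omega> = cnj (conference_period w x) \<or> v = 0 \<and> \<omega> = conference_period w x"
  using assms(1)
proof cases
  case (type_I b z)
  define d where "d = 4 * real a + 1"
  have bz: "b = d" "z = d" using type_I a by (simp_all add: d_def)
  have d: "d \<ge> 0" "0\<^sup>2 + (sqrt d)\<^sup>2 = 4 * real a + 1" unfolding d_def by simp_all
  show ?thesis
    by (rule that[OF d(2), of "conference_period w 0"])
      (simp_all add: type_I(1) bz csqrt_minus_of_real[OF d(1)] conference_period_def)
next
  case (type_II y c)
  define d where "d = 4 * real a + 1"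
  have yc: "y = d" "c = d" using type_II a by (simp_all add: d_def)
  have d: "d \<ge> 0" "(sqrt d)\<^sup>2 + 0\<^sup>2 = 4 * real a + 1" unfolding d_def by simp_all
  show ?thesis
    by (rule that[OF d(2), of "conference_period w (sqrt d)"])
      (simp_all add: type_II(1) yc csqrt_minus_of_real[OF d(1)] conference_period_def)
next
  case (type_III b c y z)
  have "real (2 * a) * (y + b) = real (2 * a) * (4 * real a + 1)"
    "real (2 * a) * (z + c) = real (2 * a) * (4 * real a + 1)"
    using type_III by (simp_all add: algebra_simps)
  then have yb: "y + b = 4 * real a + 1" and zc: "z + c = 4 * real a + 1"
    using a by (simp_all only: mult_cancel_left) simp_all
  have "y * z = b * c" using type_III a by simp
  \<comment> \<open>Substituting \<open>b = 4 * a + 1 - y\<close> and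
    \<open>z = 4 * a + 1 - c\<close> into \<open>y * z = b * c\<close> cancels the quadratic terms.
    So type III has one free parameter left.\<close>
  then have "(4 * real a + 1) * (y - c) = 0" using yb zc by Groebner_Basis.algebra
  then have c: "c = y" by (simp add: add_nonneg_eq_0_iff)
  then have z: "z = b" using yb zc by simp
  show ?thesis
    by (rule that[of "sqrt y" "sqrt b" "cnj (conference_period w (sqrt y))"])
      (use type_III yb in \<open>simp_all only: type_III(1) c z, simp_all add: csqrt_minus_of_real conference_period_def
        del: of_real_add of_real_mult of_real_minus of_real_diff\<close>)
qed

section \<open>Necessity of the congruence and the representation\<close>

text \<open>Eliminating \<open>g\<close> and \<open>h\<close> gives
  \<open>n2 + n3 = 2 * n1 + 1\<close>, so \<open>h = n2 - n3\<close> is odd; the first equation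
  makes \<open>g\<close> an odd integer. The quadratic relation then fixes the parity of
  \<open>a\<close>, which gives both congruences.\<close>

lemma odd_sum_of_squares_from_integrality:
  fixes a n1 n2 n3 :: nat and g h :: real
  assumes "8 * real n1 = 2 * real a - 3 + g"
    "8 * real n2 = 2 * real a + 1 + g + 4 * h"
    "8 * real n3 = 2 * real a + 1 + g - 4 * h"
    and sq: "4 * real a + 1 = g\<^sup>2 + 4 * h\<^sup>2"
  shows "[4 * a + 1 = 5] (mod 8) \<and> (\<exists>g h :: int. int (4 * a + 1) = g\<^sup>2 + 4 * h\<^sup>2 \<and> [g = 1] (mod 4))"
proof -
  define m where "m = 1 - int a + 4 * int n1"
  define l where "l = int n1 - int n3"
  have "real n2 + real n3 = 2 * real n1 + 1" using assms by linarith
  then have "g = of_int (2 * m + 1)" "h = of_int (2 * l + 1)"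
    using assms unfolding m_def l_def by auto
  then have "real_of_int (4 * int a + 1) = of_int ((2 * m + 1)\<^sup>2 + 4 * (2 * l + 1)\<^sup>2)"
    using sq by simp
  then have eq: "4 * int a + 1 = (2 * m + 1)\<^sup>2 + 4 * (2 * l + 1)\<^sup>2"
    by (simp only: of_int_eq_iff)
  \<comment> \<open>Since \<open>m * (m + 1)\<close> is even and the square is odd, \<open>a\<close>
    is odd. Then \<open>m\<close> is even by its definition, which is the congruence for
    \<open>g\<close>.\<close>
  then have "int a = m * (m + 1) + (2 * l + 1)\<^sup>2"
    by (simp add: power2_eq_square algebra_simps)
  then have "odd (int a)" by simp
  then obtain d where d: "int a = 2 * d + 1" by (elim oddE)
  have "[4 * a + 1 = 5] (mod 8)"
    using d unfolding cong_def by presburger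
  moreover have "[2 * m + 1 = 1] (mod 4)"
    using d unfolding m_def cong_def by presburger
  ultimately show ?thesis using eq by (intro conjI exI[of _ "2 * m + 1"] exI[of _ "2 * l + 1"]) simp_all
qed

text \<open>The three numbers with \<open>i = j = 1\<close> and \<open>l = 1, 2, 3\<close> already
  suffice. Up to sign, \<open>g\<close> and \<open>h\<close> are the real and half the imaginary
  part of \<open>w * (x + \<i> * v)\<^sup>2 / q\<close>, whose squared modulus is
  \<open>q\<close>.\<close>

lemma conference_fission_necessary:
  fixes a :: nat and w x v :: real
  assumes a: "a > 0" and w: "w\<^sup>2 = 4 * real a + 1" and xv: "x\<^sup>2 + v\<^sup>2 = 4 * real a + 1"
    and \<omega>: "\<omega> = cnj (conference_period w x) \<or> v = 0 \<and> \<omega> = conference_period w x"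
    and P: "P = fission_matrix (2 * a) (2 * a) (conference_period w x) (conference_period (- w) v)
       (conference_period (- w) v) \<omega>"
    and N: "\<And>i j l. i \<le> 4 \<Longrightarrow> j \<le> 4 \<Longrightarrow> l \<le> 4 \<Longrightarrow>
       intersection_number (4 * a + 1) (fission_mults (2 * a) (2 * a)) P i j l \<in> \<nat>"
  shows "[4 * a + 1 = 5] (mod 8) \<and> (\<exists>g h :: int. int (4 * a + 1) = g\<^sup>2 + 4 * h\<^sup>2 \<and> [g = 1] (mod 4))"
proof -
  define q where "q = 4 * real a + 1"
  have q0: "q > 0" unfolding q_def by simp
  define g where "g = w * (x\<^sup>2 - v\<^sup>2) / q"
  define h where "h = w * x * v / q"
  have g: "w * (x\<^sup>2 - v\<^sup>2) = q * g" and h: "w * x * v = q * h"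
    using q0 by (simp_all add: g_def h_def)
  define \<rho> where "\<rho> = conference_period w x"
  define \<sigma> where "\<sigma> = conference_period (- w) v"
  define K where "K = complex_of_nat a"
  note sums = conference_period_sums[OF w xv g[unfolded q_def] h[unfolded q_def],
      folded \<rho>_def \<sigma>_def K_def]
  have K: "K \<noteq> 0" "complex_of_nat (4 * a + 1) = 4 * K + 1"
    using a unfolding K_def by simp_all
  have q: "4 * K + 1 \<noteq> 0" unfolding K(2)[symmetric] by (simp only: of_nat_eq_0_iff)
  have P': "P = fission_matrix (2 * a) (2 * a) \<rho> \<sigma> \<sigma> \<omega>"
    unfolding P \<rho>_def \<sigma>_def ..
  have \<sigma>_real: "v = 0 \<Longrightarrow> cnj \<sigma> = \<sigma>" by (simp add: \<sigma>_def conference_period_def)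
  \<comment> \<open>In the degenerate type II case \<open>\<sigma>\<close> is real, so
    \<open>\<omega>\<close> enters only through \<open>\<omega> + cnj \<omega>\<close> and may be
    replaced by its conjugate.\<close>
  have mixed: "\<rho> * \<rho> * cnj \<sigma> + \<sigma> * \<sigma> * cnj \<omega> + cnj \<sigma> * cnj \<sigma> * \<omega> + cnj \<rho> * cnj \<rho> * \<sigma> =
      \<rho> * \<rho> * cnj \<sigma> + \<sigma> * \<sigma> * \<rho> + cnj \<rho> * cnj \<rho> * \<sigma> + cnj \<sigma> * cnj \<sigma> * cnj \<rho>"
    "\<rho> * \<rho> * \<sigma> + \<sigma> * \<sigma> * \<omega> + cnj \<sigma> * cnj \<sigma> * cnj \<omega> + cnj \<rho> * cnj \<rho> * cnj \<sigma> =
      \<rho> * \<rho> * \<sigma> + \<sigma> * \<sigma> * cnj \<rho> + cnj \<rho> * cnj \<rho> * cnj \<sigma> + cnj \<sigma> * cnj \<sigma> * \<rho>"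
    using \<omega>[folded \<rho>_def] \<sigma>_real by (elim disjE conjE; simp add: algebra_simps)+
  have canc: "(K * K * K + K * S) / ((4 * K + 1) * K) = (K * K + S) / (4 * K + 1)" for S
  proof -
    have "K * K * K + K * S = (K * K + S) * K" by (simp add: algebra_simps)
    then show ?thesis by (simp only: nonzero_mult_divide_mult_cancel_right[OF K(1)])
  qed
  have eight: "8 * X = Y" if "Z / (4 * K + 1) = X" "8 * Z = (4 * K + 1) * Y" for X Y Z
  proof -
    have "Z = (4 * K + 1) * X" unfolding that(1)[symmetric] using q by simp
    then have "(4 * K + 1) * (8 * X) = (4 * K + 1) * Y" using that(2) by simp
    then show ?thesis using q by (simp only: mult_cancel_left) simp
  qed
  have le: "(1::nat) \<le> 4" "(2::nat) \<le> 4" "(3::nat) \<le> 4" by simp_all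
  note I = intersection_number_fission[of _ _ _ "4 * a + 1" a \<rho> \<sigma> \<sigma> \<omega>, folded P' K_def]
  note entries = fission_matrix_entries[of a \<rho> \<sigma> \<sigma> \<omega>, folded P' K_def]
  obtain n1 where n1: "intersection_number (4 * a + 1) (fission_mults (2 * a) (2 * a)) P 1 1 1 = of_nat n1"
    using N[of 1 1 1] by (auto elim: Nats_cases)
  obtain n2 where n2: "intersection_number (4 * a + 1) (fission_mults (2 * a) (2 * a)) P 1 1 2 = of_nat n2"
    using N[of 1 1 2] by (auto elim: Nats_cases)
  obtain n3 where n3: "intersection_number (4 * a + 1) (fission_mults (2 * a) (2 * a)) P 1 1 3 = of_nat n3"
    using N[of 1 1 3] by (auto elim: Nats_cases)
  have "(K * K + (\<rho> * \<rho> * cnj \<rho> + \<sigma> * \<sigma> * cnj \<sigma> + cnj \<rho> * cnj \<rho> * \<rho> + cnj \<sigma> * cnj \<sigma> * \<sigma>)) / (4 * K + 1) = of_nat n1"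
    unfolding n1[symmetric] I[OF le(1,1,1)] entries K(2) canc complex_cnj_cnj by (simp only: add_ac)
  then have "8 * of_nat n1 = 2 * K - 3 + of_real g" using sums(7) by (rule eight)
  then have "complex_of_real (8 * real n1) = of_real (2 * real a - 3 + g)" by (simp add: K_def)
  then have e1: "8 * real n1 = 2 * real a - 3 + g" by (simp only: of_real_eq_iff)
  have "(K * K + (\<rho> * \<rho> * cnj \<sigma> + \<sigma> * \<sigma> * \<rho> + cnj \<rho> * cnj \<rho> * \<sigma> + cnj \<sigma> * cnj \<sigma> * cnj \<rho>)) / (4 * K + 1) = of_nat n2"
    unfolding n2[symmetric] I[OF le(1,1,2)] entries K(2) canc complex_cnj_cnj mixed(1) ..
  then have "8 * of_nat n2 = 2 * K + 1 + of_real g + 4 * of_real h" using sums(8) by (rule eight)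
  then have "complex_of_real (8 * real n2) = of_real (2 * real a + 1 + g + 4 * h)" by (simp add: K_def)
  then have e2: "8 * real n2 = 2 * real a + 1 + g + 4 * h" by (simp only: of_real_eq_iff)
  have "(K * K + (\<rho> * \<rho> * \<sigma> + \<sigma> * \<sigma> * cnj \<rho> + cnj \<rho> * cnj \<rho> * cnj \<sigma> + cnj \<sigma> * cnj \<sigma> * \<rho>)) / (4 * K + 1) = of_nat n3"
    unfolding n3[symmetric] I[OF le(1,1,3)] entries K(2) canc complex_cnj_cnj mixed(2) ..
  then have "8 * of_nat n3 = 2 * K + 1 + of_real g - 4 * of_real h" using sums(6) by (rule eight)
  then have "complex_of_real (8 * real n3) = of_real (2 * real a + 1 + g - 4 * h)" by (simp add: K_def)
  then have e3: "8 * real n3 = 2 * real a + 1 + g - 4 * h" by (simp only: of_real_eq_iff)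
  \<comment> \<open>The identity behind this chain is \<open>(x\<^sup>2 - v\<^sup>2)\<^sup>2 + 4 *
    x\<^sup>2 * v\<^sup>2 = (x\<^sup>2 + v\<^sup>2)\<^sup>2\<close>.\<close>
  have "q * (q * (g\<^sup>2 + 4 * h\<^sup>2)) = (q * g)\<^sup>2 + 4 * (q * h)\<^sup>2" by Groebner_Basis.algebra
  also have "\<dots> = w\<^sup>2 * (x\<^sup>2 + v\<^sup>2)\<^sup>2"
    unfolding g[symmetric] h[symmetric] by Groebner_Basis.algebra
  also have "\<dots> = q * (q * q)"
    unfolding w xv q_def by (simp only: power2_eq_square)
  finally have "q = g\<^sup>2 + 4 * h\<^sup>2" using q0 by simp
  then show ?thesis
    using odd_sum_of_squares_from_integrality[OF e1 e2 e3] unfolding q_def by blast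
qed

section \<open>Sufficiency by a type III table\<close>

text \<open>The hypothesis on \<open>a\<close> is \<open>q = g\<^sup>2 + 4 * h\<^sup>2\<close> with
  \<open>g = 4 * j + 1\<close> and \<open>h = 2 * k + 1\<close>. Taking \<open>k\<close> nonnegative
  makes \<open>h\<close> positive, matching the positive square roots in the table.\<close>

lemma conference_fission_exists:
  fixes a :: nat and j k :: int
  assumes a: "int a = 4 * j\<^sup>2 + 2 * j + (2 * k + 1)\<^sup>2" and k: "k \<ge> 0"
  defines "w \<equiv> sqrt (4 * real a + 1)"
  shows "\<exists>P. fission_character_table (4 * a + 1) (2 * a) (2 * a)
      ((- 1 + w) / 2) ((- 1 - w) / 2) ((- 1 - w) / 2) ((- 1 + w) / 2) (2 * a) (2 * a) P \<and>
    (\<forall>i\<le>4. \<forall>j\<le>4. \<forall>l\<le>4.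
       intersection_number (4 * a + 1) (fission_mults (2 * a) (2 * a)) P i j l \<in> \<nat>)"
proof -
  define g where "g = real_of_int (4 * j + 1)"
  define h where "h = real_of_int (2 * k + 1)"
  have "real_of_int (int a) = of_int (4 * j\<^sup>2 + 2 * j + (2 * k + 1)\<^sup>2)" using a by (simp only:)
  then have ra: "real a = 4 * (of_int j)\<^sup>2 + 2 * of_int j + (2 * of_int k + 1)\<^sup>2" by simp
  then have q: "4 * real a + 1 = g\<^sup>2 + 4 * h\<^sup>2"
    unfolding g_def h_def by (simp add: power2_eq_square algebra_simps)
  have h0: "h > 0" using k by (simp add: h_def)
  have w: "w\<^sup>2 = 4 * real a + 1" "w > 0" unfolding w_def by simp_all
  have "g\<^sup>2 < w\<^sup>2" using h0 unfolding w q by simp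
  then have "\<bar>g\<bar> < w" using w(2) power2_less_imp_less[of "\<bar>g\<bar>" w] by simp
  then have gw: "- w < g" "g < w" by auto
  \<comment> \<open>These values solve \<open>y + b = w\<^sup>2\<close> and
    \<open>y - b = w * g\<close>, the equations for the prescribed \<open>g\<close>. Then \<open>y *
    b = w\<^sup>2 * (w\<^sup>2 - g\<^sup>2) / 4 = (w * h)\<^sup>2\<close> produces the prescribed
    \<open>h\<close>. Positivity rests on \<open>h\<close> being nonzero, which forces
    \<open>\<bar>g\<bar> < w\<close>.\<close>
  define y where "y = w * (w + g) / 2"
  define b where "b = w * (w - g) / 2"
  have yb0: "y > 0" "b > 0" using gw w(2) by (simp_all add: y_def b_def)
  have "j * (2 * j + 1) \<ge> 0" by (cases "j \<ge> 0") (simp_all add: mult_nonpos_nonpos)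
  moreover have "(2 * k + 1)\<^sup>2 > 0" using k by simp
  ultimately have "int a > 0" unfolding a power2_eq_square by (simp add: algebra_simps)
  then have a0: "a > 0" by simp
  have yb: "y + b = 4 * real a + 1" unfolding w(1)[symmetric] y_def b_def
    by (simp add: power2_eq_square field_simps)
  have "y * b = (w * h)\<^sup>2" unfolding y_def b_def using q w(1) by (simp add: field_simps) Groebner_Basis.algebra
  then have "sqrt y * sqrt b = w * h" using w(2) h0 by (simp add: real_sqrt_mult[symmetric])
  then have hh: "w * sqrt y * sqrt b = (4 * real a + 1) * h"
    unfolding w(1)[symmetric] by (simp add: power2_eq_square)
  have xv: "(sqrt y)\<^sup>2 + (sqrt b)\<^sup>2 = 4 * real a + 1" using yb yb0 by simp
  have gg: "w * ((sqrt y)\<^sup>2 - (sqrt b)\<^sup>2) = (4 * real a + 1) * g"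
    using yb0 unfolding w(1)[symmetric] y_def b_def by (simp add: power2_eq_square field_simps)
  define \<rho> where "\<rho> = conference_period w (sqrt y)"
  define \<sigma> where "\<sigma> = conference_period (- w) (sqrt b)"
  note sums = conference_period_sums[OF w(1) xv gg hh, folded \<rho>_def \<sigma>_def]
  let ?K = "complex_of_nat a"
  have K: "complex_of_nat (4 * a + 1) = 4 * ?K + 1" by simp
  have K0: "4 * ?K + 1 \<noteq> 0" unfolding K[symmetric] by (simp only: of_nat_eq_0_iff)
  have NatsI: "X / complex_of_nat (4 * a + 1) \<in> \<nat>"
    if "8 * X = (4 * ?K + 1) * Y" "Y = of_int (8 * n)" "n \<ge> 0" for X Y n
  proof -
    have "X = (4 * ?K + 1) * of_int n" using that(1) unfolding that(2) by simp
    then have "X / complex_of_nat (4 * a + 1) = of_int n" unfolding K using K0 by simp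
    also have "\<dots> = of_nat (nat n)" using that(3) by simp
    finally show ?thesis by simp
  qed
  have "complex_of_real (real a) = of_real (4 * (of_int j)\<^sup>2 + 2 * of_int j + (2 * of_int k + 1)\<^sup>2)"
    by (simp only: ra)
  then have Ka: "?K = 4 * (of_int j)\<^sup>2 + 2 * of_int j + (2 * of_int k + 1)\<^sup>2" by simp
  have consecutive: "n * (n + 1) \<ge> 0" for n :: int
    by (cases "n \<ge> 0") (simp_all add: mult_nonpos_nonpos)
  then have consecutive': "n * (n - 1) \<ge> 0" for n :: int
    using consecutive[of "n - 1"] by (simp add: mult.commute)
  \<comment> \<open>Inserting \<open>j\<close> and \<open>k\<close> into the right-hand sides of
    \<open>sums(5)\<close> to \<open>sums(9)\<close>, without the factor \<open>4 * a + 1\<close>,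
    gives 8 times these expressions, in this order. They are nonnegative because a product of
    consecutive integers is.\<close>
  have nonneg: "j * (j - 1) + k * (k + 1) \<ge> 0" "j * (j + 1) + k\<^sup>2 \<ge> 0" "j * (j + 1) + k * (k + 1) \<ge> 0"
     "j * (j + 1) + (k + 1)\<^sup>2 \<ge> 0" "j\<^sup>2 + k * (k + 1) \<ge> 0"
    by (intro add_nonneg_nonneg consecutive consecutive' zero_le_power2)+
  have n: "intersection_number (4 * a + 1) (fission_mults (2 * a) (2 * a))
      (fission_matrix (2 * a) (2 * a) \<rho> \<sigma> \<sigma> (cnj \<rho>)) i j' l \<in> \<nat>" if "i \<le> 4" "j' \<le> 4" "l \<le> 4" for i j' l
    by (rule intersection_numbers_in_Nats[OF a0 sums(1-4)
        NatsI[OF sums(5) _ nonneg(1)] NatsI[OF sums(6) _ nonneg(2)] NatsI[OF sums(7) _ nonneg(3)]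
        NatsI[OF sums(8) _ nonneg(4)] NatsI[OF sums(9) _ nonneg(5)] that])
      (simp_all add: Ka g_def h_def power2_eq_square algebra_simps)
  have "fission_character_table (4 * a + 1) (2 * a) (2 * a)
      ((- 1 + w) / 2) ((- 1 - w) / 2) ((- 1 - w) / 2) ((- 1 + w) / 2) (2 * a) (2 * a)
      (fission_matrix (2 * a) (2 * a) \<rho> \<sigma> \<sigma> (cnj \<rho>))"
  proof -
    \<comment> \<open>The type III parameters \<open>b, c, y, z\<close> are instantiated as
      \<open>b, y, y, b\<close>.\<close>
    have m: "real (2 * a) * y + real (2 * a) * b = real (4 * a + 1) * real (2 * a)"
      "real (2 * a) * b + real (2 * a) * y = real (4 * a + 1) * real (2 * a)"
      using yb by (simp_all add: distrib_left[symmetric] add.commute)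
    have s: "real (2 * a) * sqrt (y * b) = real (2 * a) * sqrt (b * y)"
      by (simp add: mult.commute)
    have "\<rho> = (of_real ((- 1 + w) / 2) + csqrt (- of_real y)) / 2"
      "\<sigma> = (of_real ((- 1 - w) / 2) + csqrt (- of_real b)) / 2"
      "cnj \<rho> = (of_real ((- 1 + w) / 2) - csqrt (- of_real y)) / 2"
      using yb0 by (simp_all add: \<rho>_def \<sigma>_def conference_period_def csqrt_minus_of_real)
    then show ?thesis
      using fission_character_table.type_III[OF yb0(2,1,1,2) m s] by (simp only:)
  qed
  with n show ?thesis by blast
qed

section \<open>Both directions combined for \<open>q\<close>\<close>

theorem theorem3p3:
  fixes q :: nat
  assumes "q \<ge> 5" and "[q = 1] (mod 4)"
  shows "has_putative_skew_fission q ((q - 1) div 2) ((q - 5) div 4) ((q - 1) div 4) \<longleftrightarrow>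
    [q = 5] (mod 8) \<and> (\<exists>g h :: int. int q = g\<^sup>2 + 4 * h\<^sup>2 \<and> [g = 1] (mod 4))"
proof -
  have "q mod 4 = 1" using assms(2) by (simp add: cong_def)
  then obtain a where q: "q = 4 * a + 1" by (metis mult_div_mod_eq)
  have a: "a > 0" using q assms(1) by simp
  have k: "(q - 1) div 2 = 2 * a" "q - 2 * a - 1 = 2 * a" using q by auto
  note srg = srg_character_table_conference[OF assms, unfolded k]
  show ?thesis
  proof
    assume "has_putative_skew_fission q ((q - 1) div 2) ((q - 5) div 4) ((q - 1) div 4)"
    then obtain r s t u m1 m2 P where
      "srg_character_table q (2 * a) ((q - 5) div 4) ((q - 1) div 4) r s t u m1 m2"
      and f: "fission_character_table q (2 * a) (2 * a) r s t u m1 m2 P"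
      and N: "\<And>i j l. i \<le> 4 \<Longrightarrow> j \<le> 4 \<Longrightarrow> l \<le> 4 \<Longrightarrow>
        intersection_number q (fission_mults m1 m2) P i j l \<in> \<nat>"
      unfolding has_putative_skew_fission_def k by auto
    then have c: "r = (- 1 + sqrt (real q)) / 2 \<and> s = (- 1 - sqrt (real q)) / 2 \<or>
        r = (- 1 - sqrt (real q)) / 2 \<and> s = (- 1 + sqrt (real q)) / 2"
      "t = - 1 - r" "u = - 1 - s" and m: "m1 = 2 * a" "m2 = 2 * a"
      unfolding srg by auto
    \<comment> \<open>A negative \<open>w\<close> absorbs the second ordering of the two
      eigenvalues, so a single case remains.\<close>
    obtain w where w: "w\<^sup>2 = 4 * real a + 1" "r = (- 1 + w) / 2" "s = (- 1 - w) / 2"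
      using c(1)
    proof (elim disjE conjE)
      assume "r = (- 1 - sqrt (real q)) / 2" "s = (- 1 + sqrt (real q)) / 2"
      then show ?thesis using that[of "- sqrt (real q)"] by (simp add: q)
    qed (use that[of "sqrt (real q)"] in \<open>simp add: q\<close>)
    have tu: "t = (- 1 - w) / 2" "u = (- 1 + w) / 2" using c(2,3) w(2,3) by (simp_all add: field_simps)
    obtain x v \<omega> where "x\<^sup>2 + v\<^sup>2 = 4 * real a + 1"
      "\<omega> = cnj (conference_period w x) \<or> v = 0 \<and> \<omega> = conference_period w x"
      "P = fission_matrix (2 * a) (2 * a) (conference_period w x) (conference_period (- w) v)
         (conference_period (- w) v) \<omega>"
      using conference_fission_character_tableE[OF f[unfolded q m w(2,3) tu] a] by metis
    then show "[q = 5] (mod 8) \<and> (\<exists>g h :: int. int q = g\<^sup>2 + 4 * h\<^sup>2 \<and> [g = 1] (mod 4))"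
      using conference_fission_necessary[OF a w(1) _ _ _ N[unfolded q m]] unfolding q by blast
  next
    assume R: "[q = 5] (mod 8) \<and> (\<exists>g h :: int. int q = g\<^sup>2 + 4 * h\<^sup>2 \<and> [g = 1] (mod 4))"
    then obtain g h :: int where gh: "int q = g\<^sup>2 + 4 * h\<^sup>2" "[g = 1] (mod 4)" by blast
    from gh(2) have "g mod 4 = 1" by (simp add: cong_def)
    then obtain j where g: "g = 4 * j + 1" by (metis mult_div_mod_eq)
    have ah: "int a = 4 * j\<^sup>2 + 2 * j + h\<^sup>2"
      using gh(1) unfolding q g by (simp add: power2_eq_square algebra_simps)
    \<comment> \<open>Modulo 2, \<open>ah\<close> reads \<open>a = h\<^sup>2\<close>, so the
      congruence modulo 8 makes \<open>h\<close> odd. Only \<open>h\<^sup>2\<close> matters, so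
      passing to the absolute value supplies a nonnegative \<open>k'\<close>.\<close>
    have "odd (int a)" using conjunct1[OF R] unfolding q cong_def by presburger
    then have "odd h" unfolding ah by simp
    then have "odd \<bar>h\<bar>" by simp
    then obtain k' where k': "\<bar>h\<bar> = 2 * k' + 1" by (elim oddE)
    then have "k' \<ge> 0" by linarith
    moreover have "h\<^sup>2 = (2 * k' + 1)\<^sup>2" unfolding k'[symmetric] by simp
    ultimately obtain P where P: "fission_character_table q (2 * a) (2 * a)
        ((- 1 + sqrt (real q)) / 2) ((- 1 - sqrt (real q)) / 2) ((- 1 - sqrt (real q)) / 2)
        ((- 1 + sqrt (real q)) / 2) (2 * a) (2 * a) P"
      "\<forall>i\<le>4. \<forall>j\<le>4. \<forall>l\<le>4. intersection_number q (fission_mults (2 * a) (2 * a)) P i j l \<in> \<nat>"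
      using conference_fission_exists[of a j k'] ah by (auto simp: q add.commute)
    have "srg_character_table q (2 * a) ((q - 5) div 4) ((q - 1) div 4)
        ((- 1 + sqrt (real q)) / 2) ((- 1 - sqrt (real q)) / 2) ((- 1 - sqrt (real q)) / 2)
        ((- 1 + sqrt (real q)) / 2) (2 * a) (2 * a)"
      unfolding srg by (simp add: field_simps)
    with P show "has_putative_skew_fission q ((q - 1) div 2) ((q - 5) div 4) ((q - 1) div 4)"
      unfolding has_putative_skew_fission_def k by blast
  qed
qed

end
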